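(* Let $a,b$ be integers with $0<a<b$ and $\gcd(a,b)=1$, put $P=\{0,a,b\}$, and suppose $P\ne\{0,1,2\}$. Then there is an odd prime dividing at least one of the three differences $a$, $b$, $b-a$. Let $p$ be any odd prime and let $\Delta\in\{a,b,b-a\}$ be any one of these differences such that $p\mid\Delta$, and let $$q=p^{v_p(\Delta)}$$ (when several choices of $(p,\Delta)$ are available, one may in particular select one minimizing $q^2(q-1)$). If $A\subset\mathbb Z$ is finite and nonempty and $|A|=n$, then $$M_P(A)\le \frac{13}{28}(n^2-n)+\frac{q^2(q-1)}{4}(n-1).$$ In particular, $\gamma_P\le \frac{13}{28}$.
   Context: For $P=\{0,a,b\}$ and a finite set $A\subset\mathbb Z$, $M_P(A)=\#\{(x,d)\in\mathbb Z^2: d\ne 0,\ x\in A,\ x+ad\in A,\ x+bd\in A\}$. Further, $m_P(n)=\max_{|A|=n}M_P(A)$, the maximum over all $A\subset\mathbb Z$ with $|A|=n$, and $\gamma_P=\limsup_{n\to\infty} m_P(n)/n^2$. Here $v_p(\Delta)$ is the exponent of $p$ in the prime factorization of $\Delta$. *)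

theory Defs
  imports Complex_Main
    "HOL-Computational_Algebra.Primes"
    "HOL-Library.Extended_Real"
    "HOL-Library.Liminf_Limsup"
begin

definition pattern_count :: "int set \<Rightarrow> int set \<Rightarrow> nat" where
  "pattern_count P A = card {(x, d). d \<noteq> 0 \<and> (\<forall>t\<in>P. x + t * d \<in> A)}"

lemma pattern_count_triple:
  "pattern_count {0, a, b} A =
     card {(x, d). d \<noteq> 0 \<and> x \<in> A \<and> x + a * d \<in> A \<and> x + b * d \<in> A}"
  by (simp add: pattern_count_def)

definition max_pattern_count :: "int set \<Rightarrow> nat \<Rightarrow> nat" where
  "max_pattern_count P n = Max {pattern_count P A | A. finite A \<and> card A = n}"

(* The next two lemmas show that, for the patterns of interest, neither card nor Max
   is applied to an infinite set in the definitions above. *)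

lemma finite_pattern_occurrences:
  fixes a b :: int
  assumes "a \<noteq> 0" "finite A"
  shows "finite {(x, d). d \<noteq> 0 \<and> (\<forall>t\<in>{0, a, b}. x + t * d \<in> A)}" (is "finite ?S")
    and "pattern_count {0, a, b} A \<le> card A * card A"
proof -
  let ?f = "\<lambda>(x, d). (x, x + a * d)"
  have inj: "inj_on ?f ?S"
    using assms(1) by (auto simp: inj_on_def)
  have sub: "?f ` ?S \<subseteq> A \<times> A"
    by auto
  have fin: "finite (A \<times> A)"
    using assms(2) by simp
  show "finite ?S"
    using inj_on_finite[OF inj sub fin] .
  show "pattern_count {0, a, b} A \<le> card A * card A"
    using card_inj_on_le[OF inj sub fin]
    by (simp only: pattern_count_def card_cartesian_product)
qed

lemma finite_pattern_counts:
  fixes a b :: int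
  assumes "a \<noteq> 0"
  shows "finite {pattern_count {0, a, b} A | A. finite A \<and> card A = n}"
    and "{pattern_count {0, a, b} A | A. finite A \<and> card A = n} \<noteq> {}"
proof -
  have "{pattern_count {0, a, b} A | A. finite A \<and> card A = n} \<subseteq> {..n * n}"
    using finite_pattern_occurrences(2)[OF assms] by auto
  then show "finite {pattern_count {0, a, b} A | A. finite A \<and> card A = n}"
    by (rule finite_subset) simp
  have "\<exists>A::int set. finite A \<and> card A = n"
    by (rule exI[of _ "{0..<int n}"]) simp
  then show "{pattern_count {0, a, b} A | A. finite A \<and> card A = n} \<noteq> {}"
    by blast
qed

definition pattern_gamma :: "int set \<Rightarrow> ereal" where
  "pattern_gamma P = limsup (\<lambda>n. ereal (real (max_pattern_count P n) / (real n)\<^sup>2))"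

end

theory Submission
  imports Defs "HOL-Number_Theory.Cong"
begin

text \<open>
  An occurrence of the pattern is a triple of points, and \<open>\<Delta>\<close> is the coefficient of the step \<open>d\<close> in
  the difference of two of them. Call these two the ends and the third point the apex, so that the
  occurrence consists of the apex \<open>x\<close> and the ends \<open>x + e * d\<close> and \<open>x + f * d\<close> with
  \<open>f - e = \<Delta> = q * g\<close>, where \<open>e\<close> and \<open>g\<close> are coprime to the odd number \<open>q\<close>. Then the ends
  are always congruent modulo \<open>q\<close>, whereas the apex is congruent to them only if \<open>q\<close> divides \<open>d\<close>.
  Rescaling by a power of \<open>q\<close>, assume that \<open>A\<close> meets several residue classes modulo \<open>q\<close>,
  and cut each class \<open>B\<close> further into its subclasses modulo \<open>q\<^sup>2\<close>. If the apex also lies in \<open>B\<close>, the ends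
  lie in one subclass. If the apex lies in another class \<open>B'\<close>, the ends lie in different subclasses,
  which differ by a fixed nonzero shift \<open>c\<close> depending only on \<open>B\<close> and \<open>B'\<close>.

  Let \<open>n = card B\<close>, let \<open>n' = card B'\<close>, and let \<open>L\<close> be the number of ordered pairs of points of \<open>B\<close> in
  different subclasses.
  Since the ends determine the occurrence, the number \<open>M\<close> of occurrences inside \<open>B\<close> is at most
  \<open>n\<^sup>2 - n - L\<close>, and those with ends in \<open>B\<close> and apex outside number at most \<open>L\<close>. For the apex in one
  given class \<open>B'\<close> there are two further bounds:

  \<^item> at most \<open>L / 2\<close>, because the shifts by \<open>c\<close> and \<open>-c\<close> give disjoint sets of pairs
    (\<open>card_shifted_pairs_le\<close>);

  \<^item> at most \<open>3/2 * L * n' / n\<close>, because for each apex the pairs of ends form a matching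
    of \<open>B\<close> that follows the shift, and such a matching is short if one subclass is large
    (\<open>card_shifted_matching_le\<close>).

  Let \<open>\<alpha> = 5/11\<close> and suppose inductively that \<open>M \<le> \<alpha> * (n\<^sup>2 - n)\<close>. A large \<open>L\<close> diminishes \<open>M\<close>, a small \<open>L\<close>
  diminishes the number of occurrences with apex outside, and in the worst case these effects meet at
  \<open>L = (1 - \<alpha>) * (n\<^sup>2 - n)\<close> (\<open>class_bound\<close>). With this value of \<open>L\<close>, the ordered pairs \<open>(B, B')\<close>
  and \<open>(B', B)\<close> together contribute at most \<open>(1 - \<alpha>) * 5/3 * n * n'\<close> (\<open>exchange_bound\<close>). Since
  \<open>(1 - \<alpha>) * 5/3 = 2 * \<alpha>\<close>, this is exactly the mixed term of \<open>\<alpha>\<close> times the square of the sum of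
  the class sizes, and summation over the classes yields the bound \<open>\<alpha> * (n\<^sup>2 - n)\<close> for \<open>A\<close>, now with
  \<open>n = card A\<close> (\<open>count_le_if_classes\<close>, \<open>card_occurrences_le\<close>). The asserted inequality follows, because
  \<open>5/11 \<le> 13/28\<close> and the linear term is nonnegative, and dividing by \<open>n\<^sup>2\<close> gives the bound for \<open>\<gamma>\<^sub>P\<close>.
\<close>

section \<open>Occurrences of a pattern\<close>

definition occurrences :: "int \<Rightarrow> int \<Rightarrow> int set \<Rightarrow> (int \<times> int) set" where
  "occurrences e f A = {(x, d). d \<noteq> 0 \<and> x \<in> A \<and> x + e * d \<in> A \<and> x + f * d \<in> A}"

lemma pattern_count_eq_card_occurrences:
  "pattern_count {0, e, f} A = card (occurrences e f A)"
  by (simp add: pattern_count_triple occurrences_def)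

lemma finite_occurrences: "e \<noteq> 0 \<Longrightarrow> finite A \<Longrightarrow> finite (occurrences e f A)"
  using finite_pattern_occurrences(1)[of e A f] by (simp add: occurrences_def)

text \<open>
  Any of the three points of an occurrence can be made the base point; this is what allows the two ends
  to be the points whose difference is a multiple of the chosen \<open>\<Delta>\<close>.
\<close>

lemma pattern_count_translate: "pattern_count ((+) c ` P) A = pattern_count P A"
proof -
  have "bij_betw (\<lambda>(x, d). (x + c * d, d))
      {(x, d). d \<noteq> 0 \<and> (\<forall>t\<in>(+) c ` P. x + t * d \<in> A)}
      {(x, d). d \<noteq> 0 \<and> (\<forall>t\<in>P. x + t * d \<in> A)}"
    by (rule bij_betw_byWitness[where f' = "\<lambda>(x, d). (x - c * d, d)"])
       (auto simp: algebra_simps)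
  then show ?thesis
    unfolding pattern_count_def by (rule bij_betw_same_card)
qed

section \<open>Pairs following a fixed shift\<close>

definition incongruent_pairs :: "int \<Rightarrow> int set \<Rightarrow> (int \<times> int) set" where
  "incongruent_pairs N B = {(y, z). y \<in> B \<and> z \<in> B \<and> \<not> [y = z] (mod N)}"

lemma incongruent_pairs_subset: "incongruent_pairs N B \<subseteq> B \<times> B"
  by (auto simp: incongruent_pairs_def)

lemma finite_incongruent_pairs: "finite B \<Longrightarrow> finite (incongruent_pairs N B)"
  using finite_subset[OF incongruent_pairs_subset] by blast

lemma shift_incongruent:
  fixes y z :: int
  assumes "\<not> N dvd c" "[z = y + c] (mod N)"
  shows "\<not> [y = z] (mod N)"
proof
  assume "[y = z] (mod N)"
  then have "[y + 0 = y + c] (mod N)" using assms(2) cong_trans by auto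
  then have "[0 = c] (mod N)" by (simp only: cong_add_lcancel)
  then show False using assms(1) by (simp add: cong_iff_dvd_diff)
qed

text \<open>
  The pairs of \<open>H\<close> and their reversals follow the shifts \<open>c\<close> and \<open>-c\<close>. These are different modulo \<open>N\<close>
  and nonzero, so both families consist of incongruent pairs and no pair is in both.
\<close>

lemma card_shifted_pairs_le:
  assumes "finite B" "\<not> N dvd 2 * c"
    and H: "\<And>y z. (y, z) \<in> H \<Longrightarrow> y \<in> B \<and> z \<in> B \<and> [z = y + c] (mod N)"
  shows "2 * card H \<le> card (incongruent_pairs N B)"
proof -
  let ?H' = "prod.swap ` H"
  have c: "\<not> N dvd c" using assms(2) by (meson dvd_mult)
  have sub: "H \<union> ?H' \<subseteq> incongruent_pairs N B"
  proof -
    have "\<not> [y = z] (mod N)" "\<not> [z = y] (mod N)" if "(y, z) \<in> H" for y z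
      using shift_incongruent[OF c] H[OF that] by (blast dest: cong_sym)+
    then show ?thesis using H by (auto simp: incongruent_pairs_def)
  qed
  have "H \<inter> ?H' = {}"
  proof -
    have False if "(y, z) \<in> H" "(z, y) \<in> H" for y z
    proof -
      have "N dvd z - (y + c)" "N dvd y - (z + c)"
        using H[OF that(1)] H[OF that(2)] by (auto simp: cong_iff_dvd_diff)
      then have "N dvd (z - (y + c)) + (y - (z + c))" by (rule dvd_add)
      then show False using assms(2) dvd_minus_iff[of N "2 * c"] by (simp add: algebra_simps)
    qed
    then show ?thesis by auto
  qed
  moreover have fin: "finite (H \<union> ?H')"
    using finite_subset[OF sub finite_incongruent_pairs[OF assms(1)]] .
  moreover have "card ?H' = card H" by (simp add: card_image)
  ultimately have "card (H \<union> ?H') = 2 * card H"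
    by (simp add: card_Un_disjoint)
  then show ?thesis
    using card_mono[OF finite_incongruent_pairs[OF assms(1)] sub] by simp
qed

text \<open>
  Fix \<open>k \<in> B\<close> and let \<open>K\<close> be its class modulo \<open>N\<close>. A pair of \<open>H\<close> that begins in \<open>K\<close> ends in the class \<open>U\<close>
  of \<open>k + c\<close>, and one that ends in \<open>K\<close> begins in the class \<open>V\<close> of \<open>k - c\<close>. As \<open>H\<close> is a matching,
  \<open>card H\<close> is at most \<open>card (B - K) + card U\<close>, and likewise at most \<open>card (B - K) + card V\<close>. The sets \<open>U\<close>
  and \<open>V\<close> are disjoint parts of \<open>B - K\<close>, so adding gives \<open>2 * card H \<le> 3 * card (B - K)\<close>.
  Summing over \<open>k \<in> B\<close> turns the right-hand side into the number of incongruent pairs.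
\<close>

lemma card_shifted_matching_le:
  assumes fin: "finite B" and c: "\<not> N dvd 2 * c"
    and H: "\<And>y z. (y, z) \<in> H \<Longrightarrow> y \<in> B \<and> z \<in> B \<and> [z = y + c] (mod N)"
    and inj: "inj_on fst H" "inj_on snd H"
  shows "2 * card B * card H \<le> 3 * card (incongruent_pairs N B)"
proof -
  have finH: "finite H"
    by (rule finite_subset[of _ "B \<times> B"]) (use H fin in auto)
  define far where "far k = {y \<in> B. \<not> [k = y] (mod N)}" for k
  have finfar: "finite (far k)" for k using fin by (simp add: far_def)
  have c1: "\<not> N dvd c" using c by (meson dvd_mult)
  have avoid: "2 * card H \<le> 3 * card (far k)" if "k \<in> B" for k
  proof -
    define U where "U = {y \<in> B. [y = k + c] (mod N)}"
    define V where "V = {y \<in> B. [k = y + c] (mod N)}"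
    have UV: "U \<subseteq> far k" "V \<subseteq> far k"
      using shift_incongruent[OF c1] by (auto simp: U_def V_def far_def dest: cong_sym)
    have disj: "U \<inter> V = {}"
    proof -
      have False if "N dvd y - (k + c)" "N dvd k - (y + c)" for y
        using dvd_add[OF that] c dvd_minus_iff[of N "2 * c"] by (simp add: algebra_simps)
      then show ?thesis by (auto simp: U_def V_def cong_iff_dvd_diff)
    qed
    have "card U + card V \<le> card (far k)"
      using card_Un_disjoint[OF _ _ disj] card_mono[OF finfar, of "U \<union> V" k] UV
        finite_subset[OF UV(1) finfar] finite_subset[OF UV(2) finfar] by auto
    moreover have "card H \<le> card (far k) + card U"
    proof -
      let ?K = "{h \<in> H. fst h \<in> far k}" and ?L = "{h \<in> H. fst h \<notin> far k}"
      have "card H = card ?K + card ?L"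
        using finH by (subst card_Un_disjoint[symmetric]) (auto intro: arg_cong[where f = card])
      moreover have "card ?K \<le> card (far k)"
        by (rule card_inj_on_le[where f = fst]) (use inj finfar in \<open>auto intro: inj_on_subset\<close>)
      moreover have "card ?L \<le> card U"
      proof (rule card_inj_on_le[where f = snd])
        show "inj_on snd ?L" using inj(2) by (rule inj_on_subset) auto
        show "finite U" using fin by (simp add: U_def)
        show "snd ` ?L \<subseteq> U"
        proof clarsimp
          fix y z assume h: "(y, z) \<in> H" "y \<notin> far k"
          then have "[k = y] (mod N)" using H by (auto simp: far_def)
          then have "[y + c = k + c] (mod N)" by (simp add: cong_add_rcancel cong_sym)
          then show "z \<in> U" using H[OF h(1)] by (auto simp: U_def intro: cong_trans)
        qed
      qed
      ultimately show ?thesis by simp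
    qed
    moreover have "card H \<le> card (far k) + card V"
    proof -
      let ?K = "{h \<in> H. snd h \<in> far k}" and ?L = "{h \<in> H. snd h \<notin> far k}"
      have "card H = card ?K + card ?L"
        using finH by (subst card_Un_disjoint[symmetric]) (auto intro: arg_cong[where f = card])
      moreover have "card ?K \<le> card (far k)"
        by (rule card_inj_on_le[where f = snd]) (use inj finfar in \<open>auto intro: inj_on_subset\<close>)
      moreover have "card ?L \<le> card V"
      proof (rule card_inj_on_le[where f = fst])
        show "inj_on fst ?L" using inj(1) by (rule inj_on_subset) auto
        show "finite V" using fin by (simp add: V_def)
        show "fst ` ?L \<subseteq> V"
        proof clarsimp
          fix y z assume h: "(y, z) \<in> H" "z \<notin> far k"
          then have "[k = z] (mod N)" using H by (auto simp: far_def)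
          then show "y \<in> V" using H[OF h(1)] by (auto simp: V_def intro: cong_trans)
        qed
      qed
      ultimately show ?thesis by simp
    qed
    ultimately show ?thesis by linarith
  qed
  have "incongruent_pairs N B = Sigma B far"
    by (auto simp: incongruent_pairs_def far_def)
  then have "card (incongruent_pairs N B) = (\<Sum>k\<in>B. card (far k))"
    using fin finfar by simp
  moreover have "(\<Sum>k\<in>B. 2 * card H) \<le> (\<Sum>k\<in>B. 3 * card (far k))"
    by (rule sum_mono) (rule avoid)
  ultimately show ?thesis by (simp add: sum_distrib_left algebra_simps)
qed

section \<open>Real inequalities\<close>

text \<open>
  In the application, \<open>E\<close> is the number of ordered pairs of distinct points in a class, \<open>M\<close> counts the occurrences inside
  the class, and \<open>t s\<close> those with ends in the class and apex in the class \<open>s\<close>. The upper bound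
  \<open>min (\<alpha> * E) (E - L) + L * min 1 (\<Sum>s\<in>S. g s)\<close> increases with \<open>L\<close> up to \<open>L = (1 - \<alpha>) * E\<close> and then
  decreases, because the second factor of the last term is at most \<open>1\<close>; the right-hand side is an
  upper bound for its value at that point.
\<close>

lemma class_bound:
  fixes t g :: "'a \<Rightarrow> real"
  assumes "0 \<le> \<alpha>" "\<alpha> \<le> 1" "0 \<le> L" "0 \<le> E"
    and "M \<le> \<alpha> * E" and "M + L \<le> E"
    and "(\<Sum>s\<in>S. t s) \<le> L" and "\<And>s. s \<in> S \<Longrightarrow> t s \<le> L * g s" and g: "\<And>s. s \<in> S \<Longrightarrow> 0 \<le> g s"
  shows "M + (\<Sum>s\<in>S. t s) \<le> \<alpha> * E + (1 - \<alpha>) * E * (\<Sum>s\<in>S. g s)"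
proof -
  let ?G = "\<Sum>s\<in>S. g s"
  have tG: "(\<Sum>s\<in>S. t s) \<le> L * ?G"
    unfolding sum_distrib_left by (rule sum_mono) (rule assms)
  have G: "0 \<le> ?G" using g by (rule sum_nonneg)
  show ?thesis
  proof (cases "L \<le> (1 - \<alpha>) * E")
    case True
    then have "L * ?G \<le> (1 - \<alpha>) * E * ?G" using G by (rule mult_right_mono)
    then show ?thesis using tG assms by linarith
  next
    case False
    show ?thesis
    proof (cases "?G \<le> 1")
      case True
      then have "(1 - \<alpha>) * E * (1 - ?G) \<le> L * (1 - ?G)"
        using False by (intro mult_right_mono) auto
      then show ?thesis using tG assms by (simp add: algebra_simps)
    next
      case G1: False
      have "(1 - \<alpha>) * E * 1 \<le> (1 - \<alpha>) * E * ?G"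
        using G1 assms by (intro mult_left_mono) auto
      then show ?thesis using assms by (simp add: algebra_simps)
    qed
  qed
qed

text \<open>
  For \<open>z \<le> x\<close> the second summand is at most \<open>z\<^sup>2 / 2\<close>. If moreover \<open>x \<le> 3 * z\<close>, the first is at most
  \<open>x\<^sup>2 / 2\<close> and the claim becomes \<open>(3 * z - x) * (3 * x - z) \<ge> 0\<close>; otherwise the first is at most
  \<open>3/2 * x * z\<close>, and \<open>z\<^sup>2 / 2 \<le> x * z / 6\<close>. Equality holds when the ratio is \<open>3\<close>, whence the constant.
\<close>

lemma exchange_bound:
  fixes x z :: real
  assumes "0 < x" "0 < z"
  shows "x\<^sup>2 * min (1/2) (3/2 * (z / x)) + z\<^sup>2 * min (1/2) (3/2 * (x / z)) \<le> 5/3 * (x * z)"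
proof -
  have main: "x\<^sup>2 * min (1/2) (3/2 * (z / x)) + z\<^sup>2 * min (1/2) (3/2 * (x / z)) \<le> 5/3 * (x * z)"
    if xz: "0 < z" "z \<le> x" for x z :: real
  proof -
    have "z\<^sup>2 * min (1/2) (3/2 * (x / z)) \<le> z\<^sup>2 * (1/2)"
      by (intro mult_left_mono) auto
    moreover have "x\<^sup>2 * min (1/2) (3/2 * (z / x)) + z\<^sup>2 * (1/2) \<le> 5/3 * (x * z)"
    proof (cases "x \<le> 3 * z")
      case True
      have "x\<^sup>2 * min (1/2) (3/2 * (z / x)) \<le> x\<^sup>2 * (1/2)"
        by (intro mult_left_mono) auto
      moreover have "0 \<le> (3 * z - x) * (3 * x - z)" using True xz by simp
      ultimately show ?thesis by (simp add: algebra_simps power2_eq_square)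
    next
      case False
      have "x\<^sup>2 * min (1/2) (3/2 * (z / x)) \<le> x\<^sup>2 * (3/2 * (z / x))"
        by (intro mult_left_mono) auto
      moreover have "x\<^sup>2 * (3/2 * (z / x)) = 3/2 * (x * z)" using xz by (simp add: power2_eq_square)
      moreover have "3 * z * z \<le> x * z" using False xz by (intro mult_right_mono) auto
      ultimately show ?thesis by (simp add: power2_eq_square)
    qed
    ultimately show ?thesis by linarith
  qed
  show ?thesis
    using main[of z x] main[of x z] assms
    by (cases "z \<le> x") (simp_all add: add.commute mult.commute)
qed

lemma sum_off_diagonal_le_half:
  fixes h k :: "'a \<Rightarrow> 'a \<Rightarrow> real"
  assumes "finite R" and "\<And>r s. r \<in> R \<Longrightarrow> s \<in> R \<Longrightarrow> h r s + h s r \<le> k r s"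
  shows "2 * (\<Sum>r\<in>R. \<Sum>s\<in>R - {r}. h r s) \<le> (\<Sum>r\<in>R. \<Sum>s\<in>R - {r}. k r s)"
proof -
  have off: "R - {r} = {s \<in> R. s \<noteq> r}" "R - {r} = {s \<in> R. r \<noteq> s}" for r by auto
  have "(\<Sum>r\<in>R. \<Sum>s\<in>R - {r}. h r s) = (\<Sum>r\<in>R. \<Sum>s\<in>R - {r}. h s r)"
    using sum.swap_restrict[OF assms(1) assms(1), of h "\<lambda>r s. s \<noteq> r"]
    by (simp only: off(1)[symmetric] off(2)[symmetric])
  then have "2 * (\<Sum>r\<in>R. \<Sum>s\<in>R - {r}. h r s) = (\<Sum>r\<in>R. \<Sum>s\<in>R - {r}. h r s + h s r)"
    by (simp add: sum.distrib)
  also have "\<dots> \<le> (\<Sum>r\<in>R. \<Sum>s\<in>R - {r}. k r s)"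
    using assms(2) by (intro sum_mono) auto
  finally show ?thesis .
qed


section \<open>Splitting a set into residue classes\<close>

lemma exists_separating_power:
  fixes q :: int
  assumes "1 < q" "x \<in> A" "y \<in> A" "x \<noteq> y"
  shows "\<exists>k. (\<forall>u\<in>A. \<forall>v\<in>A. [u = v] (mod q ^ k)) \<and> (\<exists>u\<in>A. \<exists>v\<in>A. \<not> [u = v] (mod q ^ Suc k))"
proof -
  let ?P = "\<lambda>k. \<exists>u\<in>A. \<exists>v\<in>A. \<not> [u = v] (mod q ^ k)"
  define n where "n = nat \<bar>x - y\<bar>"
  have "int n < 2 ^ n" using of_nat_less_two_power[of n, where ?'a = int] by simp
  also have "(2::int) ^ n \<le> q ^ n" using assms(1) by (intro power_mono) auto
  finally have "\<bar>x - y\<bar> < q ^ n" by (simp add: n_def)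
  then have "?P n"
    using assms zdvd_imp_le[of "q ^ n" "\<bar>x - y\<bar>"] by (force simp: cong_iff_dvd_diff)
  moreover have "\<not> ?P 0" by simp
  ultimately obtain k where "\<forall>i\<le>k. \<not> ?P i" "?P (Suc k)"
    using ex_least_nat_less[of ?P n] by blast
  then have "\<not> ?P k" "?P (Suc k)" by blast+
  then show ?thesis by blast
qed

text \<open>
  Working modulo \<open>q ^ k\<close>, \<open>m = q ^ (k + 1)\<close> and \<open>N = q ^ (k + 2)\<close> replaces rescaling \<open>A\<close> by \<open>q ^ k\<close>: all of
  \<open>A\<close> is one class for the first modulus, its residue classes are taken for the second, and these
  are cut into subclasses by the third.
\<close>

locale split_pattern =
  fixes e g q :: int and k :: nat and A :: "int set"
  assumes q_gt_1: "1 < q" and odd_q: "odd q"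
    and coprime_e: "coprime e q" and coprime_g: "coprime g q"
    and finite_A: "finite A"
    and congruent_A: "\<And>u v. u \<in> A \<Longrightarrow> v \<in> A \<Longrightarrow> [u = v] (mod q ^ k)"
begin

definition f :: int where "f = e + q * g"
definition m :: int where "m = q ^ Suc k"
definition N :: int where "N = q * m"

definition residue_class :: "int \<Rightarrow> int set" where
  "residue_class r = {x \<in> A. x mod m = r}"

text \<open>
  The first index is the residue of the first end, the second that of the apex. The other end needs no
  index, by \<open>ends_congruent\<close> below.
\<close>

definition occurrences_between :: "int \<Rightarrow> int \<Rightarrow> (int \<times> int) set" where
  "occurrences_between r s = {(x, d) \<in> occurrences e f A. x mod m = s \<and> (x + e * d) mod m = r}"

definition ends :: "int \<times> int \<Rightarrow> int \<times> int" where
  "ends = (\<lambda>(x, d). (x + e * d, x + f * d))"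

lemma nonzero: "e \<noteq> 0" "g \<noteq> 0" "f \<noteq> 0"
proof -
  have "coprime f q"
    using coprime_e gcd_add_mult[of q g e]
    by (simp only: f_def coprime_iff_gcd_eq_1 gcd.commute[of _ q] add.commute[of e] mult.commute[of q])
  then show "e \<noteq> 0" "g \<noteq> 0" "f \<noteq> 0" using coprime_e coprime_g q_gt_1 by auto
qed

lemma finite_occurrences_A: "finite (occurrences e f A)"
  using nonzero finite_A by (simp add: finite_occurrences)

lemma m_dvd_mult_cancel: "m dvd e * d \<longleftrightarrow> m dvd d" "m dvd g * d \<longleftrightarrow> m dvd d" "m dvd 2 * d \<longleftrightarrow> m dvd d"
proof -
  have "coprime m e" "coprime m g" "coprime m 2"
    using coprime_e coprime_g odd_q unfolding m_def by (auto simp: coprime_commute simp del: power_Suc)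
  then show "m dvd e * d \<longleftrightarrow> m dvd d" "m dvd g * d \<longleftrightarrow> m dvd d" "m dvd 2 * d \<longleftrightarrow> m dvd d"
    by (auto simp: coprime_dvd_mult_right_iff)
qed

lemma N_dvd_iff: "N dvd q * g * d \<longleftrightarrow> m dvd d"
  using q_gt_1 by (simp add: N_def mult.assoc m_dvd_mult_cancel)

text \<open>
  All of \<open>A\<close> lies in one class modulo \<open>q ^ k\<close>, which forces \<open>q ^ k\<close> to divide \<open>d\<close>; the difference
  \<open>q * g * d\<close> of the ends gains another factor \<open>q\<close>.
\<close>

lemma ends_congruent:
  assumes "(x, d) \<in> occurrences e f A"
  shows "(x + f * d) mod m = (x + e * d) mod m"
proof -
  have "q ^ k dvd e * d"
    using assms congruent_A[of "x + e * d" x] by (auto simp: occurrences_def cong_iff_dvd_diff)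
  then have "q ^ k dvd d"
    using coprime_e coprime_dvd_mult_right_iff[of "q ^ k" e d]
    by (simp add: coprime_commute[of q e])
  then have "m dvd q * d" by (simp add: m_def)
  then have "m dvd g * (q * d)" by (rule dvd_mult)
  then have "m dvd (x + f * d) - (x + e * d)" by (simp add: f_def algebra_simps)
  then show ?thesis by (simp add: mod_eq_dvd_iff)
qed

lemma inj_ends: "inj_on ends H"
proof (rule inj_onI, clarify)
  fix x d x' d' assume "ends (x, d) = ends (x', d')"
  then have 1: "x + e * d = x' + e * d'" and 2: "x + f * d = x' + f * d'"
    by (auto simp: ends_def)
  then have "(f - e) * d = (f - e) * d'" by (simp add: left_diff_distrib)
  then have "d = d'" using nonzero q_gt_1 by (simp add: f_def)
  with 1 show "x = x' \<and> d = d'" by simp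
qed

lemma occurrences_between_same: "occurrences_between r r = occurrences e f (residue_class r)"
proof -
  have "(x + f * d) mod m = r" if "(x, d) \<in> occurrences e f A" "(x + e * d) mod m = r" for x d
    using ends_congruent[OF that(1)] that(2) by simp
  then show ?thesis
    by (auto simp: occurrences_between_def residue_class_def occurrences_def)
qed

lemma ends_in_class:
  assumes "(x, d) \<in> occurrences_between r s"
  shows "x \<in> residue_class s" "x + e * d \<in> residue_class r" "x + f * d \<in> residue_class r"
  using assms ends_congruent[of x d]
  by (auto simp: occurrences_between_def residue_class_def occurrences_def)

lemma ends_congruent_iff: "[x + e * d = x + f * d] (mod N) \<longleftrightarrow> m dvd d"
  using N_dvd_iff[of d] dvd_diff_commute[of N "x + e * d" "x + f * d"]
  by (simp add: cong_iff_dvd_diff f_def algebra_simps)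

lemma dvd_step_iff:
  assumes "(x, d) \<in> occurrences_between r s"
  shows "m dvd d \<longleftrightarrow> r = s"
proof -
  have "r = s \<longleftrightarrow> m dvd (x + e * d) - x"
    using assms mod_eq_dvd_iff[of "x + e * d" m x]
    by (simp add: occurrences_between_def eq_commute[of r s])
  then show ?thesis by (simp add: m_dvd_mult_cancel)
qed

lemma finite_residue_class: "finite (residue_class r)"
  using finite_A by (simp add: residue_class_def)

lemma finite_occurrences_between: "finite (occurrences_between r s)"
  using finite_occurrences_A by (rule rev_finite_subset) (auto simp: occurrences_between_def)

abbreviation split_pairs :: "int \<Rightarrow> (int \<times> int) set" where
  "split_pairs r \<equiv> incongruent_pairs N (residue_class r)"

text \<open>
  The ends of an occurrence inside a class are distinct and congruent modulo \<open>N\<close>. They are thus found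
  among the pairs that remain after removing the incongruent pairs and the diagonal.
\<close>

lemma card_within_class_le:
  "card (occurrences_between r r) + card (split_pairs r) + card (residue_class r)
     \<le> (card (residue_class r))\<^sup>2"
proof -
  let ?B = "residue_class r"
  let ?E = "ends ` occurrences_between r r" and ?D = "(\<lambda>y. (y, y)) ` ?B"
  have E: "y \<in> ?B \<and> z \<in> ?B \<and> y \<noteq> z \<and> [y = z] (mod N)" if "(y, z) \<in> ?E" for y z
  proof -
    obtain x d where xd: "(x, d) \<in> occurrences_between r r" "y = x + e * d" "z = x + f * d"
      using \<open>(y, z) \<in> ?E\<close> by (auto simp: ends_def)
    have "d \<noteq> 0" using xd(1) by (auto simp: occurrences_between_def occurrences_def)
    then show ?thesis
      using ends_in_class[OF xd(1)] dvd_step_iff[OF xd(1)] nonzero q_gt_1 xd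
      by (simp add: ends_congruent_iff) (simp add: f_def)
  qed
  have "card (occurrences_between r r) + card (split_pairs r) + card ?B
      = card ?E + card (split_pairs r) + card ?D"
    by (simp add: card_image[OF inj_ends] card_image[of "\<lambda>y. (y, y)"] inj_on_def)
  also have "\<dots> = card (?E \<union> split_pairs r \<union> ?D)"
  proof -
    have "?E \<inter> split_pairs r = {}" "(?E \<union> split_pairs r) \<inter> ?D = {}"
      using E by (auto simp: incongruent_pairs_def)
    then show ?thesis
      by (simp add: card_Un_disjoint finite_incongruent_pairs finite_residue_class finite_occurrences_between)
  qed
  also have "\<dots> \<le> card (?B \<times> ?B)"
    using E by (intro card_mono) (auto simp: finite_residue_class incongruent_pairs_def)
  finally show ?thesis by (simp only: power2_eq_square card_cartesian_product)
qed

lemma card_from_outside_le: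
  assumes "finite S" "r \<notin> S"
  shows "(\<Sum>s\<in>S. card (occurrences_between r s)) \<le> card (split_pairs r)"
proof -
  have "(\<Sum>s\<in>S. card (occurrences_between r s)) = card (\<Union>s\<in>S. occurrences_between r s)"
    using assms(1)
    by (subst card_UN_disjoint) (auto simp: finite_occurrences_between, auto simp: occurrences_between_def)
  also have "\<dots> \<le> card (split_pairs r)"
  proof (rule card_inj_on_le[OF inj_ends])
    show "finite (split_pairs r)" by (simp add: finite_incongruent_pairs finite_residue_class)
    show "ends ` (\<Union>s\<in>S. occurrences_between r s) \<subseteq> split_pairs r"
    proof clarsimp
      fix x d s assume s: "s \<in> S" and xd: "(x, d) \<in> occurrences_between r s"
      have "\<not> m dvd d" using dvd_step_iff[OF xd] s assms(2) by auto
      then show "ends (x, d) \<in> split_pairs r"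
        using ends_in_class[OF xd] by (simp add: ends_def incongruent_pairs_def ends_congruent_iff)
    qed
  qed
  finally show ?thesis .
qed

text \<open>
  The residues modulo \<open>m\<close> of the apex and of an end determine \<open>e * d\<close>, hence \<open>d\<close>, modulo \<open>m\<close>, and so
  determine the difference \<open>q * g * d\<close> of the ends modulo \<open>N\<close>.
\<close>

lemma obtain_shift:
  assumes "r \<noteq> s" "occurrences_between r s \<noteq> {}"
  obtains c where "\<not> N dvd 2 * c"
    "\<And>x d. (x, d) \<in> occurrences_between r s \<Longrightarrow> [x + f * d = (x + e * d) + c] (mod N)"
proof -
  obtain x0 d0 where 0: "(x0, d0) \<in> occurrences_between r s" using assms(2) by auto
  show thesis
  proof (rule that[of "q * g * d0"])
    show "\<not> N dvd 2 * (q * g * d0)"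
      using N_dvd_iff[of "2 * d0"] dvd_step_iff[OF 0] assms(1)
      by (simp add: m_dvd_mult_cancel mult.left_commute)
    fix x d assume xd: "(x, d) \<in> occurrences_between r s"
    have "m dvd (x + e * d) - (x0 + e * d0)" "m dvd x - x0"
      using xd 0 by (simp_all add: occurrences_between_def flip: mod_eq_dvd_iff)
    then have "m dvd ((x + e * d) - (x0 + e * d0)) - (x - x0)" by (rule dvd_diff)
    then have "m dvd e * (d - d0)" by (simp add: algebra_simps)
    then have "N dvd q * g * (d - d0)" by (simp only: m_dvd_mult_cancel N_dvd_iff)
    then show "[x + f * d = (x + e * d) + q * g * d0] (mod N)"
      by (simp add: cong_iff_dvd_diff f_def algebra_simps)
  qed
qed

lemma card_between_le_half:
  assumes "r \<noteq> s"
  shows "2 * card (occurrences_between r s) \<le> card (split_pairs r)"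
proof (cases "occurrences_between r s = {}")
  case False
  from obtain_shift[OF assms this] obtain c where c: "\<not> N dvd 2 * c"
    "\<And>x d. (x, d) \<in> occurrences_between r s \<Longrightarrow> [x + f * d = (x + e * d) + c] (mod N)"
    by blast
  have "2 * card (ends ` occurrences_between r s) \<le> card (split_pairs r)"
    by (rule card_shifted_pairs_le[OF finite_residue_class c(1)])
       (use c(2) ends_in_class in \<open>auto simp: ends_def\<close>)
  then show ?thesis by (simp add: card_image inj_ends)
qed simp

text \<open>
  With the apex fixed, each end determines the other, so that the pairs of ends form a matching.
\<close>

lemma card_between_le_matching:
  assumes "r \<noteq> s"
  shows "2 * card (residue_class r) * card (occurrences_between r s)
    \<le> 3 * card (residue_class s) * card (split_pairs r)"
proof (cases "occurrences_between r s = {}")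
  case False
  from obtain_shift[OF assms this] obtain c where c: "\<not> N dvd 2 * c"
    "\<And>x d. (x, d) \<in> occurrences_between r s \<Longrightarrow> [x + f * d = (x + e * d) + c] (mod N)"
    by blast
  define D where "D x = {d. (x, d) \<in> occurrences_between r s}" for x
  have eq: "occurrences_between r s = Sigma (residue_class s) D"
    using ends_in_class(1) by (auto simp: D_def)
  have finD: "finite (D x)" for x
  proof -
    have "D x = snd ` {h \<in> occurrences_between r s. fst h = x}" by (force simp: D_def)
    then show ?thesis using finite_occurrences_between by simp
  qed
  have "2 * card (residue_class r) * card (D x) \<le> 3 * card (split_pairs r)" for x
  proof -
    let ?H = "(\<lambda>d. ends (x, d)) ` D x"
    have "2 * card (residue_class r) * card ?H \<le> 3 * card (split_pairs r)"
      by (rule card_shifted_matching_le[OF finite_residue_class c(1)])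
         (use c(2) ends_in_class nonzero in \<open>auto simp: ends_def D_def inj_on_def\<close>)
    moreover have "card ?H = card (D x)"
      using nonzero by (intro card_image) (auto simp: ends_def inj_on_def)
    ultimately show ?thesis by simp
  qed
  then have "(\<Sum>x\<in>residue_class s. 2 * card (residue_class r) * card (D x))
      \<le> (\<Sum>x\<in>residue_class s. 3 * card (split_pairs r))"
    by (intro sum_mono)
  moreover have "card (occurrences_between r s) = (\<Sum>x\<in>residue_class s. card (D x))"
    unfolding eq using finD finite_residue_class by simp
  ultimately show ?thesis by (simp add: sum_distrib_left algebra_simps)
qed simp

text \<open>
  The class bounds leave a sum over the ordered pairs of different classes. Grouping each pair with its
  reversal makes \<open>exchange_bound\<close> applicable, and the outcome is just the part of \<open>(card A)\<^sup>2\<close> that mixes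
  different classes.
\<close>

lemma count_le_if_classes:
  assumes IH: "\<And>r. r \<in> (\<lambda>x. x mod m) ` A \<Longrightarrow> real (card (occurrences e f (residue_class r)))
    \<le> 5/11 * ((real (card (residue_class r)))\<^sup>2 - real (card (residue_class r)))"
  shows "real (card (occurrences e f A)) \<le> 5/11 * ((real (card A))\<^sup>2 - real (card A))"
proof -
  define R where "R = (\<lambda>x. x mod m) ` A"
  define c where "c r = real (card (residue_class r))" for r
  define t where "t r s = real (card (occurrences_between r s))" for r s
  define w where "w r s = min (1/2) (3/2 * (c s / c r))" for r s
  have finR: "finite R" using finite_A by (simp add: R_def)
  have c_ge_1: "1 \<le> c r" if "r \<in> R" for r
  proof -
    have "residue_class r \<noteq> {}" using that by (auto simp: R_def residue_class_def)
    then have "card (residue_class r) \<noteq> 0" using finite_residue_class by simp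
    then show ?thesis by (simp add: c_def)
  qed

  have total: "real (card (occurrences e f A)) = (\<Sum>r\<in>R. t r r + (\<Sum>s\<in>R - {r}. t r s))"
  proof -
    have "occurrences e f A = (\<Union>p\<in>R \<times> R. occurrences_between (fst p) (snd p))"
      by (auto simp: occurrences_between_def R_def) (auto simp: occurrences_def)
    then have "card (occurrences e f A) = card (\<Union>p\<in>R \<times> R. occurrences_between (fst p) (snd p))"
      by (rule arg_cong)
    also have "\<dots> = (\<Sum>p\<in>R \<times> R. card (occurrences_between (fst p) (snd p)))"
      using finR by (intro card_UN_disjoint) (auto simp: finite_occurrences_between, auto simp: occurrences_between_def)
    also have "\<dots> = (\<Sum>r\<in>R. \<Sum>s\<in>R. card (occurrences_between r s))"
      by (simp add: sum.cartesian_product split_def)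
    finally show ?thesis
      using finR by (simp add: t_def sum.remove[of R] cong: sum.cong)
  qed
  have n: "real (card A) = (\<Sum>r\<in>R. c r)"
  proof -
    have "A = (\<Union>r\<in>R. residue_class r)" by (auto simp: R_def residue_class_def)
    then have "card A = card (\<Union>r\<in>R. residue_class r)" by (rule arg_cong)
    also have "\<dots> = (\<Sum>r\<in>R. card (residue_class r))"
      using finR by (intro card_UN_disjoint) (auto simp: finite_residue_class, auto simp: residue_class_def)
    finally show ?thesis by (simp add: c_def)
  qed
  have off: "(\<Sum>r\<in>R. \<Sum>s\<in>R - {r}. c r * c s) = (real (card A))\<^sup>2 - (\<Sum>r\<in>R. (c r)\<^sup>2)"
  proof -
    have "(\<Sum>s\<in>R - {r}. c r * c s) = c r * real (card A) - (c r)\<^sup>2" if "r \<in> R" for r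
      using finR that unfolding n by (simp add: sum_diff1 power2_eq_square right_diff_distrib flip: sum_distrib_left)
    then show ?thesis
      by (simp add: sum_subtractf power2_eq_square n flip: sum_distrib_right)
  qed

  have class_r: "t r r + (\<Sum>s\<in>R - {r}. t r s)
      \<le> 5/11 * ((c r)\<^sup>2 - c r) + 6/11 * (\<Sum>s\<in>R - {r}. (c r)\<^sup>2 * w r s)" if r: "r \<in> R" for r
  proof -
    let ?E = "(c r)\<^sup>2 - c r" and ?L = "real (card (split_pairs r))"
    have w0: "0 \<le> w r s" for s by (simp add: w_def c_def)
    have E: "0 \<le> ?E" using c_ge_1[OF r] by (simp add: power2_eq_square)
    have "t r r + (\<Sum>s\<in>R - {r}. t r s)
        \<le> 5/11 * ?E + (1 - 5/11) * ?E * (\<Sum>s\<in>R - {r}. w r s)"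
    proof (rule class_bound[where L = ?L])
      show "t r r \<le> 5/11 * ?E"
        using IH[of r] r by (simp add: R_def t_def c_def occurrences_between_same)
      have "real (card (occurrences_between r r) + card (split_pairs r) + card (residue_class r))
          \<le> real ((card (residue_class r))\<^sup>2)"
        by (simp only: of_nat_le_iff card_within_class_le)
      then show "t r r + ?L \<le> ?E" by (simp add: t_def c_def)
      have "real (\<Sum>s\<in>R - {r}. card (occurrences_between r s)) \<le> ?L"
        using finR by (simp only: of_nat_le_iff) (rule card_from_outside_le, auto)
      then show "(\<Sum>s\<in>R - {r}. t r s) \<le> ?L" by (simp add: t_def)
      fix s assume s: "s \<in> R - {r}"
      have "real (2 * card (occurrences_between r s)) \<le> ?L"
        using s by (simp only: of_nat_le_iff) (rule card_between_le_half, auto)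
      moreover have "real (2 * card (residue_class r) * card (occurrences_between r s))
          \<le> real (3 * card (residue_class s) * card (split_pairs r))"
        using s by (simp only: of_nat_le_iff) (rule card_between_le_matching, auto)
      ultimately have "2 * t r s \<le> ?L" "2 * c r * t r s \<le> 3 * c s * ?L"
        by (simp_all add: t_def c_def)
      then have "t r s \<le> ?L * (1/2)" "t r s \<le> ?L * (3/2 * (c s / c r))"
        using c_ge_1[OF r] by (simp_all add: field_simps)
      then show "t r s \<le> ?L * w r s" by (simp add: w_def min_def)
    qed (use E w0 in auto)
    also have "\<dots> = 5/11 * ?E + 6/11 * (\<Sum>s\<in>R - {r}. ?E * w r s)"
      by (simp flip: sum_distrib_left)
    also have "\<dots> \<le> 5/11 * ?E + 6/11 * (\<Sum>s\<in>R - {r}. (c r)\<^sup>2 * w r s)"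
      using w0 by (intro add_left_mono mult_left_mono sum_mono mult_right_mono) (auto simp: c_def)
    finally show ?thesis .
  qed

  have "2 * (\<Sum>r\<in>R. \<Sum>s\<in>R - {r}. (c r)\<^sup>2 * w r s) \<le> (\<Sum>r\<in>R. \<Sum>s\<in>R - {r}. 5/3 * (c r * c s))"
  proof (rule sum_off_diagonal_le_half[OF finR])
    fix r s assume "r \<in> R" "s \<in> R"
    then show "(c r)\<^sup>2 * w r s + (c s)\<^sup>2 * w s r \<le> 5/3 * (c r * c s)"
      unfolding w_def using c_ge_1[of r] c_ge_1[of s] by (intro exchange_bound) auto
  qed
  also have "\<dots> = 5/3 * (\<Sum>r\<in>R. \<Sum>s\<in>R - {r}. c r * c s)"
    by (simp only: sum_distrib_left)
  finally have cross: "2 * (\<Sum>r\<in>R. \<Sum>s\<in>R - {r}. (c r)\<^sup>2 * w r s)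
      \<le> 5/3 * ((real (card A))\<^sup>2 - (\<Sum>r\<in>R. (c r)\<^sup>2))"
    by (simp only: off)
  have "real (card (occurrences e f A))
      \<le> (\<Sum>r\<in>R. 5/11 * ((c r)\<^sup>2 - c r) + 6/11 * (\<Sum>s\<in>R - {r}. (c r)\<^sup>2 * w r s))"
    unfolding total by (intro sum_mono class_r)
  also have "\<dots> = 5/11 * ((\<Sum>r\<in>R. (c r)\<^sup>2) - real (card A))
      + 6/11 * (\<Sum>r\<in>R. \<Sum>s\<in>R - {r}. (c r)\<^sup>2 * w r s)"
    by (simp only: n sum.distrib sum_subtractf sum_distrib_left right_diff_distrib)
  \<comment> \<open>As \<open>6/11 * 5/6 = 5/11\<close>, the sums of \<open>(c r)\<^sup>2\<close> cancel.\<close>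
  finally show ?thesis using cross by (simp add: algebra_simps)
qed

end

section \<open>The bound for three-point patterns\<close>

text \<open>
  Two distinct points of \<open>A\<close> become incongruent modulo some power of \<open>q\<close>. At the first power where \<open>A\<close>
  is no longer a single class, all its classes are proper subsets, so the induction step applies.
\<close>

theorem card_occurrences_le:
  fixes e g q :: int
  assumes q: "1 < q" "odd q" and "coprime e q" "coprime g q" and "finite A"
  shows "real (card (occurrences e (e + q * g) A)) \<le> 5/11 * ((real (card A))\<^sup>2 - real (card A))"
  using \<open>finite A\<close>
proof (induction A rule: finite_psubset_induct)
  case (psubset A)
  show ?case
  proof (cases "\<exists>x\<in>A. \<exists>y\<in>A. x \<noteq> y")
    case False
    have "e \<noteq> 0" using assms by auto
    have "(x, d) \<notin> occurrences e (e + q * g) A" for x d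
    proof
      assume "(x, d) \<in> occurrences e (e + q * g) A"
      then have "x \<in> A" "x + e * d \<in> A" "d \<noteq> 0" by (simp_all add: occurrences_def)
      moreover from this have "x = x + e * d" using False by blast
      ultimately show False using \<open>e \<noteq> 0\<close> by simp
    qed
    then have "occurrences e (e + q * g) A = {}" by auto
    then show ?thesis using le_square[of "card A"] by (simp add: power2_eq_square flip: of_nat_mult)
  next
    case True
    then obtain x y where "x \<in> A" "y \<in> A" "x \<noteq> y" by blast
    from exists_separating_power[OF q(1) this]
    obtain k where same: "\<And>u v. u \<in> A \<Longrightarrow> v \<in> A \<Longrightarrow> [u = v] (mod q ^ k)"
      and split: "\<exists>u\<in>A. \<exists>v\<in>A. \<not> [u = v] (mod q ^ Suc k)"
      by blast
    interpret split_pattern e g q k A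
      using assms psubset(1) same by (intro split_pattern.intro) auto
    have "residue_class r \<subset> A" for r
    proof -
      obtain u v where "u \<in> A" "v \<in> A" "u mod m \<noteq> v mod m"
        using split unfolding m_def cong_def by blast
      then have "u \<notin> residue_class r \<or> v \<notin> residue_class r"
        by (simp add: residue_class_def)
      moreover have "residue_class r \<subseteq> A" by (auto simp: residue_class_def)
      ultimately show ?thesis using \<open>u \<in> A\<close> \<open>v \<in> A\<close> by blast
    qed
    then show ?thesis
      using count_le_if_classes psubset.IH by (simp add: f_def)
  qed
qed

text \<open>
  Unless one of the three differences is odd and larger than \<open>1\<close>, coprimality leaves only \<open>b\<close> even and
  \<open>a = b - a = 1\<close>, which is the excluded pattern.
\<close>

lemma odd_prime_divides_difference:
  fixes a b :: int
  assumes "0 < a" "a < b" "gcd a b = 1" "{0, a, b} \<noteq> {0, 1, 2}"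
  shows "\<exists>p::int. prime p \<and> odd p \<and> (p dvd a \<or> p dvd b \<or> p dvd (b - a))"
proof -
  have odd_case: "\<exists>p::int. prime p \<and> odd p \<and> p dvd n" if "1 < n" "odd n" for n :: int
  proof -
    obtain p where "prime p" "p dvd n" using prime_factor_int[of n] \<open>1 < n\<close> by auto
    then show ?thesis using \<open>odd n\<close> dvd_trans[of 2 p n] by blast
  qed
  show ?thesis
  proof (cases "odd b")
    case True
    then show ?thesis using odd_case[of b] assms by auto
  next
    case False
    then have "odd a" using assms(3) gcd_greatest[of 2 a b] by auto
    moreover have "odd (b - a)" using False \<open>odd a\<close> by simp
    moreover have "1 < a \<or> 1 < b - a"
    proof (rule ccontr)
      assume "\<not> (1 < a \<or> 1 < b - a)"
      then have "a = 1" "b = 2" using assms(1,2) by auto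
      then show False using assms(4) by simp
    qed
    ultimately show ?thesis using odd_case[of a] odd_case[of "b - a"] by auto
  qed
qed

text \<open>
  The differences \<open>a\<close>, \<open>b\<close> and \<open>b - a\<close> are pairwise coprime, so \<open>p\<close> divides only \<open>\<Delta>\<close>. The base point is
  moved to the point that does not take part in the difference \<open>\<Delta>\<close>.
\<close>

lemma pattern_count_le:
  fixes a b p \<Delta> :: int
  assumes "0 < a" "a < b" "gcd a b = 1"
    and p: "prime p" "odd p" "p dvd \<Delta>" and \<Delta>: "\<Delta> \<in> {a, b, b - a}" and "finite A"
  shows "real (pattern_count {0, a, b} A) \<le> 5/11 * ((real (card A))\<^sup>2 - real (card A))"
proof -
  define q where "q = p ^ multiplicity p \<Delta>"
  have \<Delta>0: "\<Delta> \<noteq> 0" using \<Delta> assms by auto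
  then have "multiplicity p \<Delta> \<noteq> 0"
    using p multiplicity_gt_zero_iff[of \<Delta> p] not_prime_unit[of p] by auto
  then have q: "1 < q" "odd q"
    using p prime_gt_1_int[OF p(1)] by (auto simp: q_def one_less_power)
  obtain g where g: "\<Delta> = q * g" "\<not> p dvd g"
    using multiplicity_decompose'[of \<Delta> p] \<Delta>0 p unfolding q_def by (metis not_prime_unit)
  have coprime_q: "coprime u q" if "\<not> p dvd u" for u
    using that p(1) by (simp add: q_def coprime_commute prime_imp_coprime)
  have "\<not> (p dvd a \<and> p dvd b)"
    using assms(3) gcd_greatest[of p a b] not_prime_unit[of p] p(1) by auto
  then have ndvd: "\<not> (p dvd a \<and> p dvd b)" "\<not> (p dvd a \<and> p dvd b - a)" "\<not> (p dvd b \<and> p dvd b - a)"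
    using dvd_add[of p a "b - a"] dvd_diff[of p b "b - a"] by auto
  have bound: "real (pattern_count {0, e, e + \<Delta>} A) \<le> 5/11 * ((real (card A))\<^sup>2 - real (card A))"
    if "\<not> p dvd e" for e
    using card_occurrences_le[OF q coprime_q[OF that] coprime_q[OF g(2)] \<open>finite A\<close>]
    by (simp add: pattern_count_eq_card_occurrences g(1))
  consider "\<Delta> = b - a" | "\<Delta> = a" | "\<Delta> = b" using \<Delta> by auto
  then show ?thesis
  proof cases
    case 1
    then show ?thesis using bound[of a] ndvd p(3) by auto
  next
    case 2
    have "(+) (- b) ` {0, a, b} = {0, - b, - b + \<Delta>}" using 2 by auto
    then show ?thesis
      using bound[of "- b"] ndvd p(3) 2 pattern_count_translate[of "- b" "{0, a, b}" A] by auto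
  next
    case 3
    have "(+) (- a) ` {0, a, b} = {0, - a, - a + \<Delta>}" using 3 by auto
    then show ?thesis
      using bound[of "- a"] ndvd p(3) 3 pattern_count_translate[of "- a" "{0, a, b}" A] by auto
  qed
qed

theorem theorem1p3:
  fixes a b :: int and P :: "int set"
  assumes "0 < a" and "a < b" and "gcd a b = 1"
    and "P = {0, a, b}" and "P \<noteq> {0, 1, 2}"
  shows "(\<exists>p::int. prime p \<and> odd p \<and> (p dvd a \<or> p dvd b \<or> p dvd (b - a)))
    \<and> (\<forall>(p::int) (\<Delta>::int) (q::int) (A::int set) (n::nat).
          prime p \<longrightarrow> odd p \<longrightarrow> \<Delta> \<in> {a, b, b - a} \<longrightarrow> p dvd \<Delta> \<longrightarrow>
          q = p ^ multiplicity p \<Delta> \<longrightarrow>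
          finite A \<longrightarrow> A \<noteq> {} \<longrightarrow> card A = n \<longrightarrow>
          real (pattern_count P A) \<le>
            13 / 28 * ((real n)\<^sup>2 - real n)
            + (real_of_int q)\<^sup>2 * (real_of_int q - 1) / 4 * (real n - 1))
    \<and> pattern_gamma P \<le> ereal (13 / 28)"
proof (intro conjI allI impI)
  show ex: "\<exists>p::int. prime p \<and> odd p \<and> (p dvd a \<or> p dvd b \<or> p dvd (b - a))"
    using odd_prime_divides_difference[OF assms(1-3)] assms(4,5) by simp
  show "real (pattern_count P A) \<le> 13 / 28 * ((real n)\<^sup>2 - real n)
      + (real_of_int q)\<^sup>2 * (real_of_int q - 1) / 4 * (real n - 1)"
    if "prime p" "odd p" "\<Delta> \<in> {a, b, b - a}" "p dvd \<Delta>" "q = p ^ multiplicity p \<Delta>"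
      "finite A" "A \<noteq> {}" "card A = n" for p \<Delta> q A n
  proof -
    have n: "1 \<le> real n" using that(6-8) by (metis One_nat_def Suc_leI card_gt_0_iff of_nat_1 of_nat_mono)
    have "1 \<le> q" using that(5) prime_gt_0_int[OF that(1)] by simp
    then have "0 \<le> (real_of_int q)\<^sup>2 * (real_of_int q - 1) / 4 * (real n - 1)" using n by simp
    moreover have "0 \<le> (real n)\<^sup>2 - real n" using n by (simp add: power2_eq_square)
    moreover have "real (pattern_count P A) \<le> 5/11 * ((real n)\<^sup>2 - real n)"
      using pattern_count_le[OF assms(1-3) that(1,2,4,3,6)] assms(4) that(8) by simp
    ultimately show ?thesis by linarith
  qed
  obtain p \<Delta> :: int where p: "prime p" "odd p" "p dvd \<Delta>" "\<Delta> \<in> {a, b, b - a}"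
    using ex by blast
  have "ereal (real (max_pattern_count P n) / (real n)\<^sup>2) \<le> ereal (13 / 28)" for n
  proof -
    have "max_pattern_count P n \<in> {pattern_count P A | A. finite A \<and> card A = n}"
      unfolding max_pattern_count_def assms(4) using finite_pattern_counts[of a b n] assms(1)
      by (intro Max_in) auto
    then obtain A where A: "finite A" "card A = n" "max_pattern_count P n = pattern_count P A"
      by blast
    have "real (max_pattern_count P n) \<le> 5/11 * ((real n)\<^sup>2 - real n)"
      using pattern_count_le[OF assms(1-3) p A(1)] A assms(4) by simp
    also have "\<dots> \<le> 13/28 * (real n)\<^sup>2" by (simp add: algebra_simps)
    finally show ?thesis by (cases "n = 0") (simp_all add: divide_le_eq)
  qed
  then show "pattern_gamma P \<le> ereal (13 / 28)"
    unfolding pattern_gamma_def by (intro Limsup_bounded always_eventually allI)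
qed

end
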